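(* Every bounded automorphism $a\in\mathrm{Aut}(T)$ has finite orbit-signalizer, i.e. the set $\mathrm{OS}(a)=\{a^m|_v : v\in X^*,\ m=|\mathrm{Orb}_a(v)|\}$ is finite.
   Context: Let $X=\{1,2,\ldots,d\}$ and let $T$ be the regular rooted $d$-ary tree whose vertices are the words in $X^*$. $\mathrm{Aut}(T)$ is the group of automorphisms of $T$ as a rooted tree, acting on the right ($v^{gh}=(v^g)^h$). For $g\in\mathrm{Aut}(T)$ and $v\in X^*$, the state $g|_v\in\mathrm{Aut}(T)$ is the unique automorphism with $(vw)^g=v^g\,w^{g|_v}$ for all $w\in X^*$. $\mathrm{Orb}_a(v)$ is the orbit of $v$ under $\langle a\rangle$. An automorphism $g$ is finite-state if $\{g|_v:v\in X^*\}$ is finite. A finite-state automorphism $g$ is bounded if the sequence $\theta_k(g)=|\{v\in X^k: g|_v\text{ acts non-trivially on }X\}|$, $k\ge 0$, is bounded. *)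

theory Defs
  imports "HOL-Algebra.Algebra"
begin

(* The alphabet X = {1,...,d} is rendered as a type 'x of class finite, with d = CARD('x).
   The vertex set X^* of the tree T is the type 'x list; its root is []. *)

definition tree_adj :: "'x list \<Rightarrow> 'x list \<Rightarrow> bool" where
  "tree_adj u v \<longleftrightarrow> (\<exists>x. v = u @ [x] \<or> u = v @ [x])"

definition tree_automorphism :: "('x list \<Rightarrow> 'x list) \<Rightarrow> bool" where
  "tree_automorphism g \<longleftrightarrow>
     bij g \<and> g [] = [] \<and> (\<forall>u v. tree_adj (g u) (g v) \<longleftrightarrow> tree_adj u v)"

(* The action is on the right: v^g is written g v, and the product of g and h
   applies g first. *)
definition Aut_T :: "('x list \<Rightarrow> 'x list) monoid" where
  "Aut_T = \<lparr>carrier = {g. tree_automorphism g}, monoid.mult = (\<lambda>g h v. h (g v)), one = id\<rparr>"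

definition state :: "('x list \<Rightarrow> 'x list) \<Rightarrow> 'x list \<Rightarrow> ('x list \<Rightarrow> 'x list)" where
  "state g v = (THE h. h \<in> carrier Aut_T \<and> (\<forall>w. g (v @ w) = g v @ h w))"

definition Orb :: "('x list \<Rightarrow> 'x list) \<Rightarrow> 'x list \<Rightarrow> 'x list set" where
  "Orb a v = (\<lambda>g. g v) ` generate Aut_T {a}"

definition finite_state :: "('x list \<Rightarrow> 'x list) \<Rightarrow> bool" where
  "finite_state g \<longleftrightarrow> finite {state g v | v. True}"

definition theta :: "('x list \<Rightarrow> 'x list) \<Rightarrow> nat \<Rightarrow> nat" where
  "theta g k = card {v. length v = k \<and> (\<exists>x. state g v [x] \<noteq> [x])}"

definition bounded_automorphism :: "('x list \<Rightarrow> 'x list) \<Rightarrow> bool" where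
  "bounded_automorphism g \<longleftrightarrow>
     g \<in> carrier Aut_T \<and> finite_state g \<and> (\<exists>C. \<forall>k. theta g k \<le> C)"

definition OS :: "('x list \<Rightarrow> 'x list) \<Rightarrow> ('x list \<Rightarrow> 'x list) set" where
  "OS a = {state (a [^]\<^bsub>Aut_T\<^esub> card (Orb a v)) v | v. True}"


lemma carrier_Aut_T [simp]: "g \<in> carrier Aut_T \<longleftrightarrow> tree_automorphism g"
  and mult_Aut_T [simp]: "g \<otimes>\<^bsub>Aut_T\<^esub> h = (\<lambda>v. h (g v))"
  and one_Aut_T [simp]: "\<one>\<^bsub>Aut_T\<^esub> = id"
  by (simp_all add: Aut_T_def)

lemma group_Aut_T: "group Aut_T"
proof (rule groupI)
  fix g h :: "'x list \<Rightarrow> 'x list"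
  assume "g \<in> carrier Aut_T" "h \<in> carrier Aut_T"
  then show "g \<otimes>\<^bsub>Aut_T\<^esub> h \<in> carrier Aut_T"
    using bij_comp[of g h] by (simp add: tree_automorphism_def comp_def)
next
  fix g :: "'x list \<Rightarrow> 'x list"
  assume g: "g \<in> carrier Aut_T"
  then have b: "bij g" by (simp add: tree_automorphism_def)
  then have inv: "g (inv_into UNIV g v) = v" "inv_into UNIV g (g v) = v" for v
    by (simp_all add: bij_is_surj surj_f_inv_f bij_is_inj)
  have "inv_into UNIV g [] = []"
    using g inv(2)[of "[]"] by (simp add: tree_automorphism_def)
  moreover have "tree_adj (inv_into UNIV g u) (inv_into UNIV g v) \<longleftrightarrow> tree_adj u v" for u v
  proof -
    have "tree_adj (g (inv_into UNIV g u)) (g (inv_into UNIV g v)) \<longleftrightarrow>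
        tree_adj (inv_into UNIV g u) (inv_into UNIV g v)"
      using g by (simp add: tree_automorphism_def)
    then show ?thesis by (simp add: inv)
  qed
  ultimately have "tree_automorphism (inv_into UNIV g)"
    using bij_imp_bij_inv[OF b] by (simp add: tree_automorphism_def)
  then show "\<exists>h\<in>carrier Aut_T. h \<otimes>\<^bsub>Aut_T\<^esub> g = \<one>\<^bsub>Aut_T\<^esub>"
    by (intro bexI[of _ "inv_into UNIV g"]) (simp_all add: fun_eq_iff inv)
qed (simp_all add: tree_automorphism_def)

lemma tree_automorphism_snoc:
  assumes g: "tree_automorphism g"
  shows "length (g v) = length v \<and> (\<exists>y. g (v @ [x]) = g v @ [y])"
proof (induction v arbitrary: x rule: rev_induct)
  case Nil
  have root: "g [] = []" using g by (simp add: tree_automorphism_def)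
  have "tree_adj (g []) (g [x]) \<longleftrightarrow> tree_adj [] [x]"
    using g unfolding tree_automorphism_def by blast
  then show ?case by (simp add: root tree_adj_def)
next
  case (snoc z v)
  obtain y where y: "g (v @ [z]) = g v @ [y]" using snoc.IH by blast
  have "tree_adj (g (v @ [z])) (g (v @ [z, x])) \<longleftrightarrow> tree_adj (v @ [z]) (v @ [z, x])"
    using g unfolding tree_automorphism_def by blast
  then have "tree_adj (g (v @ [z])) (g (v @ [z, x]))" by (simp add: tree_adj_def)
  moreover have "g (v @ [z, x]) \<noteq> g v"
    using g by (simp add: tree_automorphism_def bij_def inj_eq)
  ultimately show ?case using snoc.IH y by (auto simp: tree_adj_def)
qed

lemma length_tree_automorphism [simp]: "tree_automorphism g \<Longrightarrow> length (g v) = length v"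
  by (simp add: tree_automorphism_snoc)

lemma tree_automorphism_prefix:
  assumes g: "tree_automorphism g"
  shows "\<exists>u. g (v @ w) = g v @ u"
proof (induction w rule: rev_induct)
  case (snoc x w)
  then show ?case using tree_automorphism_snoc[OF g, of "v @ w" x] by auto
qed simp

(* The definite description in the definition of state is well-defined. *)
lemma state_ex1:
  assumes g: "tree_automorphism g"
  shows "\<exists>!h. h \<in> carrier Aut_T \<and> (\<forall>w. g (v @ w) = g v @ h w)"
proof -
  have "\<forall>w. \<exists>u. g (v @ w) = g v @ u" using tree_automorphism_prefix[OF g] by blast
  then obtain h where h: "\<And>w. g (v @ w) = g v @ h w" by metis
  have inj: "g u = g w \<longleftrightarrow> u = w" for u w
    using g by (simp add: tree_automorphism_def bij_def inj_eq)
  have adj: "tree_adj (p @ u) (p @ w) \<longleftrightarrow> tree_adj u w" for p u w :: "'a list"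
    by (simp add: tree_adj_def)
  have "\<exists>w. h w = u" for u
  proof -
    obtain z where z: "g z = g v @ u"
      using g by (metis tree_automorphism_def bij_pointE)
    have len: "length z = length v + length u"
      using z g by (metis length_append length_tree_automorphism)
    obtain t where t: "g z = g (take (length v) z) @ t"
      using tree_automorphism_prefix[OF g, of "take (length v) z" "drop (length v) z"] by auto
    have "g (take (length v) z) = g v"
      using z t len g by simp
    then have "z = v @ drop (length v) z" by (metis inj append_take_drop_id)
    then show ?thesis using z h by (metis same_append_eq)
  qed
  then have "surj h" by (metis surj_def)
  moreover have "inj h" by (rule injI) (metis h inj same_append_eq)
  moreover have "h [] = []" using h[of "[]"] by simp
  moreover have "tree_adj (h u) (h w) \<longleftrightarrow> tree_adj u w" for u w
  proof -
    have "tree_adj (g (v @ u)) (g (v @ w)) \<longleftrightarrow> tree_adj (v @ u) (v @ w)"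
      using g by (simp add: tree_automorphism_def)
    then show ?thesis by (simp add: h adj)
  qed
  ultimately have "tree_automorphism h" by (simp add: tree_automorphism_def bij_def)
  moreover have "h' = h" if "\<forall>w. g (v @ w) = g v @ h' w" for h'
  proof
    fix w
    have "g v @ h' w = g v @ h w" using that[rule_format, of w] h[of w] by (rule trans[OF sym])
    then show "h' w = h w" by simp
  qed
  ultimately show ?thesis using h by (intro ex1I[of _ h]) (simp, blast)
qed

lemma state_automorphism: "tree_automorphism g \<Longrightarrow> tree_automorphism (state g v)"
  and state_append: "tree_automorphism g \<Longrightarrow> g (v @ w) = g v @ state g v w"
  using theI'[OF state_ex1[of g v], folded state_def] by simp_all

end

theory Submission
  imports Defs
begin

text \<open>
  Put \<open>m = |Orb\<^sub>a(v)|\<close>.  By the cocycle rule for states, \<open>a\<^sup>m|\<^sub>v\<close> is the product of the states of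
  \<open>a\<close> at \<open>v, v\<^sup>a, \<dots>\<close> (\<open>m\<close> factors), and these \<open>m\<close> vertices are pairwise distinct and lie on one
  level of the tree.  The length \<open>m\<close> of the product is unbounded, but trivial factors may be
  dropped, so what matters is how many vertices of a level carry a non-trivial state.

  Boundedness controls only the states that move a letter.  For a finite-state automorphism this
  suffices: a non-trivial state moves a letter after some word \<open>w\<close>, and since there are finitely
  many states, the length of \<open>w\<close> can be bounded by a constant \<open>N\<close> that does not depend on the
  vertex.  Hence \<open>v \<mapsto> vw\<close> injects the vertices with non-trivial state at level \<open>k\<close> into those
  with letter-moving state at the levels \<open>k, \<dots>, k + N\<close>, and their number is at most
  \<open>(N + 1) C\<close> when \<open>\<theta>\<^sub>k(a) \<le> C\<close> for all \<open>k\<close>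
  (lemma \<open>bounded_automorphism_nontrivial_states\<close>).

  So every orbit signalizer is a product of boundedly many factors from the finite set of
  states of \<open>a\<close>, and there are only finitely many such products.
\<close>

section \<open>States of products and iterates\<close>

lemma state_eqI:
  assumes "tree_automorphism g" "\<And>w. g (v @ w) = g v @ h w"
  shows "state g v = h"
proof
  fix w
  show "state g v w = h w"
    using state_append[OF assms(1), of v w] assms(2)[of w] by simp
qed

lemma state_state:
  assumes g: "tree_automorphism g"
  shows "state (state g v) w = state g (v @ w)"
proof (rule state_eqI[OF state_automorphism[OF g]])
  fix u
  have "g v @ state g v (w @ u) = g (v @ w) @ state g (v @ w) u"
    using state_append[OF g, of v "w @ u"] state_append[OF g, of "v @ w" u] by simp
  then show "state g v (w @ u) = state g v w @ state g (v @ w) u"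
    using state_append[OF g, of v w] by simp
qed

lemma Aut_T_pow: "a [^]\<^bsub>Aut_T\<^esub> (n::nat) = a ^^ n"
  by (induction n) (auto simp: nat_pow_def fun_eq_iff)

lemma tree_automorphism_funpow:
  assumes "tree_automorphism a"
  shows "tree_automorphism (a ^^ n)"
proof -
  interpret group Aut_T by (rule group_Aut_T)
  have "a [^]\<^bsub>Aut_T\<^esub> n \<in> carrier Aut_T"
    using assms by (intro nat_pow_closed) simp
  then show ?thesis by (simp add: Aut_T_pow)
qed

text \<open>
  The cocycle rule \<open>(gh)|\<^sub>v = g|\<^sub>v h|\<^bsub>v^g\<^esub>\<close>, iterated, with the trivial factors deleted.  The list of
  factors is reversed because \<open>\<circ>\<close> applies its right argument first.
\<close>

lemma state_funpow:
  assumes a: "tree_automorphism a"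
  shows "state (a ^^ m) v =
    foldr (\<circ>) (filter (\<lambda>q. q \<noteq> id) (rev (map (\<lambda>i. state a ((a ^^ i) v)) [0..<m]))) id"
proof (induction m)
  case 0
  have "tree_automorphism (id :: 'a list \<Rightarrow> 'a list)"
    by (simp add: tree_automorphism_def)
  then have "state id v = id" by (rule state_eqI) simp
  then show ?case by (simp add: id_def)
next
  case (Suc m)
  have step: "state (a ^^ Suc m) v = state a ((a ^^ m) v) \<circ> state (a ^^ m) v"
    by (rule state_eqI[OF tree_automorphism_funpow[OF a]])
      (simp add: state_append[OF a] state_append[OF tree_automorphism_funpow[OF a]])
  have cons: "rev (map f [0..<Suc m]) = f m # rev (map f [0..<m])" for f :: "nat \<Rightarrow> 'b"
    by simp
  have foldr_cons: "foldr f (q # qs) s = f q (foldr f qs s)" for f q qs and s :: 'c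
    by simp
  show ?case
    unfolding step Suc.IH cons
    by (cases "state a ((a ^^ m) v) = id")
      (simp_all only: filter.simps foldr_cons id_comp simp_thms if_True if_False)
qed

section \<open>Orbits\<close>

text \<open>
  If \<open>v\<close> returns to itself after \<open>p\<close> steps, then the first \<open>p\<close> iterates are permuted by \<open>a\<close>
  and by its inverse, so they exhaust the orbit.
\<close>

lemma Orb_subset_period:
  assumes a: "tree_automorphism a" and p: "p > 0" "(a ^^ p) v = v"
  shows "Orb a v \<subseteq> (\<lambda>i. (a ^^ i) v) ` {..<p}" (is "_ \<subseteq> ?S")
proof -
  interpret group Aut_T by (rule group_Aut_T)
  have iter: "(a ^^ i) v \<in> ?S" for i
  proof -
    have "(a ^^ i) v = (a ^^ (i mod p)) v"
      using p(2) by (rule funpow_mod_eq[symmetric])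
    then show ?thesis using p(1) by auto
  qed
  have closed: "g u \<in> ?S" if "g \<in> generate Aut_T {a}" "u \<in> ?S" for g u
    using that
  proof (induction arbitrary: u rule: generate.induct)
    case one
    then show ?case by simp
  next
    case (incl h)
    then obtain i where "u = (a ^^ i) v" by auto
    then show ?case using incl iter[of "Suc i"] by simp
  next
    case (inv h)
    then obtain i where i: "u = (a ^^ i) v" by auto
    have h: "h = a" using inv by simp
    \<comment> \<open>One step backwards is \<open>p - 1\<close> steps forwards.\<close>
    have "u = (a ^^ (i + p)) v" by (simp add: i funpow_add p(2))
    also have "i + p = Suc (i + (p - 1))" using p(1) by simp
    finally have u: "u = a ((a ^^ (i + (p - 1))) v)" by simp
    have "a \<otimes>\<^bsub>Aut_T\<^esub> inv\<^bsub>Aut_T\<^esub> a = \<one>\<^bsub>Aut_T\<^esub>"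
      using a by (intro r_inv) simp
    then have "(inv\<^bsub>Aut_T\<^esub> a) (a w) = w" for w by (simp add: fun_eq_iff)
    then show ?case using iter u h by simp
  next
    case (eng h1 h2)
    then show ?case by simp
  qed
  have "v \<in> ?S" using iter[of 0] by simp
  then show ?thesis using closed by (auto simp: Orb_def)
qed

text \<open>
  Two equal iterates would give a period smaller than the size of the orbit.
\<close>

lemma inj_on_iterates_Orb:
  assumes a: "tree_automorphism a"
  shows "inj_on (\<lambda>i. (a ^^ i) v) {..<card (Orb a v)}"
proof (rule linorder_inj_onI')
  fix i j
  assume ij: "i < j" "j \<in> {..<card (Orb a v)}"
  show "(a ^^ i) v \<noteq> (a ^^ j) v"
  proof
    assume eq: "(a ^^ i) v = (a ^^ j) v"
    have "(a ^^ j) v = (a ^^ i) ((a ^^ (j - i)) v)"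
      using ij(1) funpow_add[of i "j - i" a] by simp
    moreover have "inj (a ^^ i)"
      using tree_automorphism_funpow[OF a] by (simp add: tree_automorphism_def bij_def)
    ultimately have "(a ^^ (j - i)) v = v"
      using eq by (metis injD)
    then have "Orb a v \<subseteq> (\<lambda>l. (a ^^ l) v) ` {..<j - i}"
      using Orb_subset_period[OF a, of "j - i" v] ij(1) by simp
    then have "card (Orb a v) \<le> j - i"
      using surj_card_le[of "{..<j - i}" "Orb a v"] by simp
    then show False using ij by simp
  qed
qed

section \<open>Non-trivial states of a bounded automorphism\<close>

text \<open>Take for \<open>w\<close> the part of a moved word before the first letter that changes.\<close>

lemma nontrivial_state_moves_letter:
  assumes g: "tree_automorphism g" and "g \<noteq> id"
  shows "\<exists>w x. state g w [x] \<noteq> [x]"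
proof (rule ccontr)
  assume fixes_letters: "\<nexists>w x. state g w [x] \<noteq> [x]"
  have "g w = w" for w
  proof (induction w rule: rev_induct)
    case Nil
    then show ?case using g by (simp add: tree_automorphism_def)
  next
    case (snoc x w)
    then show ?case using state_append[OF g, of w "[x]"] fixes_letters by simp
  qed
  with \<open>g \<noteq> id\<close> show False by (simp add: fun_eq_iff)
qed

text \<open>The depth can be chosen uniformly because there are only finitely many states.\<close>

lemma finite_state_moves_letter_uniformly:
  assumes g: "tree_automorphism g" and fin: "finite_state g"
  shows "\<exists>N. \<forall>v. state g v \<noteq> id \<longrightarrow> (\<exists>w x. length w \<le> N \<and> state g (v @ w) [x] \<noteq> [x])"
proof -
  have "\<forall>q. \<exists>w. q \<in> range (state g) \<longrightarrow> q \<noteq> id \<longrightarrow> (\<exists>x. state q w [x] \<noteq> [x])"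
    using nontrivial_state_moves_letter state_automorphism[OF g] by blast
  then obtain d where
    d: "\<And>q. q \<in> range (state g) \<Longrightarrow> q \<noteq> id \<Longrightarrow> \<exists>x. state q (d q) [x] \<noteq> [x]"
    by metis
  have "finite (range (state g))"
    using fin by (simp add: finite_state_def full_SetCompr_eq)
  then have "finite ((\<lambda>q. length (d q)) ` range (state g))" by (rule finite_imageI)
  then obtain N where "\<forall>n \<in> (\<lambda>q. length (d q)) ` range (state g). n \<le> N"
    using finite_nat_set_iff_bounded_le by blast
  then have N: "length (d (state g v)) \<le> N" for v by auto
  have "\<exists>x. state g (v @ d (state g v)) [x] \<noteq> [x]" if "state g v \<noteq> id" for v
    using d[of "state g v"] that state_state[OF g] by auto
  then show ?thesis using N by blast
qed

text \<open>
  Each vertex \<open>v\<close> with non-trivial state is extended to a vertex at most \<open>N\<close> levels below that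
  \<open>\<theta>\<close> counts.
\<close>

lemma bounded_automorphism_nontrivial_states:
  fixes g :: "'x::finite list \<Rightarrow> 'x list"
  assumes "bounded_automorphism g"
  shows "\<exists>B. \<forall>k. card {v. length v = k \<and> state g v \<noteq> id} \<le> B"
proof -
  have g: "tree_automorphism g" and fin: "finite_state g"
    using assms by (auto simp: bounded_automorphism_def)
  obtain C where C: "\<And>k. theta g k \<le> C"
    using assms by (auto simp: bounded_automorphism_def)
  obtain N where "\<forall>v. state g v \<noteq> id \<longrightarrow>
      (\<exists>w x. length w \<le> N \<and> state g (v @ w) [x] \<noteq> [x])"
    using finite_state_moves_letter_uniformly[OF g fin] by blast
  then obtain e where e: "\<And>v. state g v \<noteq> id \<Longrightarrow>
      length (e v) \<le> N \<and> (\<exists>x. state g (v @ e v) [x] \<noteq> [x])"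
    by metis
  define M where "M k = {v. length v = k \<and> (\<exists>x. state g v [x] \<noteq> [x])}" for k
  have finM: "finite (M k)" for k
    using finite_lists_length_eq[of "UNIV :: 'x set" k]
    by (rule rev_finite_subset) (auto simp: M_def)
  have "card {v. length v = k \<and> state g v \<noteq> id} \<le> (N + 1) * C" for k
  proof -
    let ?D = "{v. length v = k \<and> state g v \<noteq> id}"
    have "card ?D \<le> card (\<Union>j\<in>{..N}. M (k + j))"
    proof (rule card_inj_on_le)
      \<comment> \<open>Injective because the prefix of length \<open>k\<close> recovers \<open>v\<close>.\<close>
      show "inj_on (\<lambda>v. v @ e v) ?D" by (rule inj_onI) simp
      show "(\<lambda>v. v @ e v) ` ?D \<subseteq> (\<Union>j\<in>{..N}. M (k + j))"
        using e by (fastforce simp: M_def)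
      show "finite (\<Union>j\<in>{..N}. M (k + j))" using finM by simp
    qed
    also have "\<dots> \<le> (\<Sum>j\<in>{..N}. card (M (k + j)))"
      by (rule card_UN_le) simp
    also have "\<dots> \<le> (\<Sum>j\<in>{..N}. C)"
      using C by (intro sum_mono) (simp add: M_def theta_def)
    finally show ?thesis by simp
  qed
  then show ?thesis by blast
qed

section \<open>Finiteness of the orbit-signalizer\<close>

theorem proposition9:
  fixes a :: "'x::finite list \<Rightarrow> 'x list"
  assumes "bounded_automorphism a"
  shows "finite (OS a)"
proof -
  have a: "tree_automorphism a" and fin: "finite_state a"
    using assms by (auto simp: bounded_automorphism_def)
  obtain B where B: "\<And>k. card {v. length v = k \<and> state a v \<noteq> id} \<le> B"
    using bounded_automorphism_nontrivial_states[OF assms] by blast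
  define Q where "Q = range (state a)"
  define W where "W = {qs. set qs \<subseteq> Q \<and> length qs \<le> B}"
  have "finite Q"
    using fin by (simp add: Q_def finite_state_def full_SetCompr_eq)
  then have "finite W" unfolding W_def by (rule finite_lists_length_le)
  moreover have "OS a \<subseteq> (\<lambda>qs. foldr (\<circ>) qs id) ` W"
  proof
    fix s
    assume "s \<in> OS a"
    then obtain v where s: "s = state (a ^^ card (Orb a v)) v"
      by (auto simp: OS_def Aut_T_pow)
    define m where "m = card (Orb a v)"
    define qs where
      "qs = filter (\<lambda>q. q \<noteq> id) (rev (map (\<lambda>i. state a ((a ^^ i) v)) [0..<m]))"
    let ?I = "{i. i < m \<and> state a ((a ^^ i) v) \<noteq> id}"
    have "length qs = card ?I"
      unfolding qs_def length_filter_conv_card length_filter_map comp_def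
        rev_filter[symmetric] length_rev
      by (rule arg_cong[of _ _ card]) auto
    also have "\<dots> \<le> card {u. length u = length v \<and> state a u \<noteq> id}"
    proof (rule card_inj_on_le)
      show "inj_on (\<lambda>i. (a ^^ i) v) ?I"
        using inj_on_iterates_Orb[OF a, of v] by (rule inj_on_subset) (auto simp: m_def)
      show "(\<lambda>i. (a ^^ i) v) ` ?I \<subseteq> {u. length u = length v \<and> state a u \<noteq> id}"
        using tree_automorphism_funpow[OF a] by auto
      show "finite {u. length u = length v \<and> state a u \<noteq> id}"
        using finite_lists_length_eq[of "UNIV :: 'x set" "length v"]
        by (rule rev_finite_subset) auto
    qed
    also have "\<dots> \<le> B" by (rule B)
    finally have "qs \<in> W" by (auto simp: W_def qs_def Q_def)
    moreover have "s = foldr (\<circ>) qs id"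
      using state_funpow[OF a, of m v] by (simp add: s m_def qs_def)
    ultimately show "s \<in> (\<lambda>qs. foldr (\<circ>) qs id) ` W" by blast
  qed
  ultimately show ?thesis by (meson finite_imageI finite_subset)
qed

end
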